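(* Let $A\in\mathbb{R}^{n\times n}$ be a symmetric positive definite matrix, let $B\in\mathbb{R}^{m\times n}$ and $C\in\mathbb{R}^{p\times m}$ be full row rank matrices, and let $s>0$. Suppose $\lambda$ is a real eigenvalue of the preconditioned matrix $\mathcal{P}_{PESS}^{-1}\mathcal{A}$. Then $$\lambda\in\left(0,\ \frac{\xi_{\max}}{1+s\,\xi_{\max}}\right],$$ where $\xi_{\max}=\lambda_{\max}(\Lambda_1^{-1}A)$.
   Context: The saddle point matrix is $\mathcal{A}=\begin{bmatrix}A&B^T&0\\-B&0&-C^T\\0&C&0\end{bmatrix}$. $\Lambda_1\in\mathbb{R}^{n\times n}$, $\Lambda_2\in\mathbb{R}^{m\times m}$, $\Lambda_3\in\mathbb{R}^{p\times p}$ are symmetric positive definite matrices, $\Sigma=\mathrm{diag}(\Lambda_1,\Lambda_2,\Lambda_3)$, and for $s>0$ the PESS preconditioner is $$\mathcal{P}_{PESS}=\Sigma+s\mathcal{A}=\begin{bmatrix}\Lambda_1+sA&sB^T&0\\-sB&\Lambda_2&-sC^T\\0&sC&\Lambda_3\end{bmatrix},$$ which is nonsingular. For a matrix with real eigenvalues, $\lambda_{\max}(\cdot)$ denotes its maximum eigenvalue. *)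

theory Defs
  imports "HOL-Analysis.Analysis"
begin

definition sym_pos_def :: "real^'n^'n \<Rightarrow> bool" where
  "sym_pos_def M \<longleftrightarrow> transpose M = M \<and> (\<forall>x. x \<noteq> 0 \<longrightarrow> x \<bullet> (M *v x) > 0)"

definition full_row_rank :: "real^'n^'m \<Rightarrow> bool" where
  "full_row_rank M \<longleftrightarrow> rank M = CARD('m)"

definition eigenvalue :: "'a::field^'n^'n \<Rightarrow> 'a \<Rightarrow> bool" where
  "eigenvalue M k \<longleftrightarrow> (\<exists>v. v \<noteq> 0 \<and> M *v v = k *s v)"

text \<open>Only meant for matrices all of whose complex eigenvalues are real (and hence
  form a finite nonempty set of reals).\<close>

definition lambda_max :: "real^'n^'n \<Rightarrow> real" where
  "lambda_max M = Max {k. eigenvalue M k}"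

text \<open>Block matrices are indexed by the disjoint sum of the index types of the three
  diagonal blocks; the arguments are listed row by row.\<close>

definition block3 ::
  "real^'n^'n \<Rightarrow> real^'m^'n \<Rightarrow> real^'p^'n \<Rightarrow>
   real^'n^'m \<Rightarrow> real^'m^'m \<Rightarrow> real^'p^'m \<Rightarrow>
   real^'n^'p \<Rightarrow> real^'m^'p \<Rightarrow> real^'p^'p \<Rightarrow>
   real^('n + 'm + 'p)^('n + 'm + 'p)" where
  "block3 M11 M12 M13 M21 M22 M23 M31 M32 M33 = (\<chi> r c.
     (case r of
        Inl i \<Rightarrow>
          (case c of Inl j \<Rightarrow> M11 $ i $ j | Inr (Inl j) \<Rightarrow> M12 $ i $ j | Inr (Inr j) \<Rightarrow> M13 $ i $ j)
      | Inr (Inl i) \<Rightarrow>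
          (case c of Inl j \<Rightarrow> M21 $ i $ j | Inr (Inl j) \<Rightarrow> M22 $ i $ j | Inr (Inr j) \<Rightarrow> M23 $ i $ j)
      | Inr (Inr i) \<Rightarrow>
          (case c of Inl j \<Rightarrow> M31 $ i $ j | Inr (Inl j) \<Rightarrow> M32 $ i $ j | Inr (Inr j) \<Rightarrow> M33 $ i $ j)))"

definition saddle_matrix ::
  "real^'n^'n \<Rightarrow> real^'n^'m \<Rightarrow> real^'m^'p \<Rightarrow> real^('n + 'm + 'p)^('n + 'm + 'p)" where
  "saddle_matrix A B C =
     block3 A     (transpose B) 0
            (- B) 0             (- transpose C)
            0     C             0"

definition block_diag3 ::
  "real^'n^'n \<Rightarrow> real^'m^'m \<Rightarrow> real^'p^'p \<Rightarrow> real^('n + 'm + 'p)^('n + 'm + 'p)" where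
  "block_diag3 L1 L2 L3 = block3 L1 0 0 0 L2 0 0 0 L3"

definition P_PESS ::
  "real^'n^'n \<Rightarrow> real^'m^'m \<Rightarrow> real^'p^'p \<Rightarrow> real \<Rightarrow>
   real^'n^'n \<Rightarrow> real^'n^'m \<Rightarrow> real^'m^'p \<Rightarrow> real^('n + 'm + 'p)^('n + 'm + 'p)" where
  "P_PESS L1 L2 L3 s A B C = block_diag3 L1 L2 L3 + s *\<^sub>R saddle_matrix A B C"

lemma P_PESS_block3:
  "P_PESS L1 L2 L3 s A B C =
     block3 (L1 + s *\<^sub>R A) (s *\<^sub>R transpose B) 0
            (- (s *\<^sub>R B))   L2                  (- (s *\<^sub>R transpose C))
            0                (s *\<^sub>R C)           L3"
  by (simp add: P_PESS_def block_diag3_def saddle_matrix_def block3_def vec_eq_iff split: sum.split)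

end

theory Submission
  imports Defs
begin

text \<open>An eigenvector \<open>(x, y, z)\<close> satisfies \<open>(1 - s \<lambda>) \<A> v = \<lambda> \<Sigma> v\<close>, so
  \<open>\<mu> = \<lambda> / (1 - s \<lambda>)\<close> is a real generalised eigenvalue of \<open>(\<A>, \<Sigma>)\<close>. The off-diagonal blocks
  of \<open>\<A>\<close> are skew, whence \<open>x \<bullet> A x = \<mu> (v \<bullet> \<Sigma> v) \<ge> \<mu> (x \<bullet> \<Lambda>1 x)\<close>. The rank conditions force
  \<open>x \<noteq> 0\<close>, hence \<open>\<mu> > 0\<close>, and \<open>\<mu>\<close> is at most the Rayleigh quotient of \<open>(A, \<Lambda>1)\<close> at \<open>x\<close>. The
  bound on \<open>\<lambda> = \<mu> / (1 + s \<mu>)\<close> follows by monotonicity.\<close>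

section \<open>Block vectors and the blockwise action of block matrices\<close>

definition join3 :: "'a^'n \<Rightarrow> 'a^'m \<Rightarrow> 'a^'p \<Rightarrow> 'a^('n + 'm + 'p)" where
  "join3 x y z = (\<chi> r. case r of Inl i \<Rightarrow> x $ i | Inr (Inl i) \<Rightarrow> y $ i | Inr (Inr i) \<Rightarrow> z $ i)"

lemma join3_cases: obtains x y z where "v = join3 x y z"
proof
  show "v = join3 (\<chi> i. v $ Inl i) (\<chi> i. v $ Inr (Inl i)) (\<chi> i. v $ Inr (Inr i))"
    by (simp add: join3_def vec_eq_iff split: sum.split)
qed

lemma join3_eq_iff: "join3 x y z = join3 x' y' z' \<longleftrightarrow> x = x' \<and> y = y' \<and> z = z'"
  by (auto simp: join3_def vec_eq_iff split: sum.splits)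

lemma join3_0: "join3 0 0 0 = 0"
  by (simp add: join3_def vec_eq_iff split: sum.split)

lemma join3_scaleR: "c *\<^sub>R join3 x y z = join3 (c *\<^sub>R x) (c *\<^sub>R y) (c *\<^sub>R z)"
  by (simp add: join3_def vec_eq_iff split: sum.split)

lemma sum_UNIV_Plus:
  fixes f :: "'a::finite + 'b::finite \<Rightarrow> 'c::comm_monoid_add"
  shows "sum f UNIV = (\<Sum>i\<in>UNIV. f (Inl i)) + (\<Sum>i\<in>UNIV. f (Inr i))"
  using sum.Plus[of "UNIV :: 'a set" "UNIV :: 'b set" f] by (simp add: UNIV_Plus_UNIV)

lemma inner_join3: "join3 x y z \<bullet> join3 x' y' z' = x \<bullet> x' + y \<bullet> y' + z \<bullet> z'"
  by (simp add: inner_vec_def join3_def sum_UNIV_Plus add.assoc)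

lemma block3_mult_join3:
  "block3 M11 M12 M13 M21 M22 M23 M31 M32 M33 *v join3 x y z =
     join3 (M11 *v x + M12 *v y + M13 *v z) (M21 *v x + M22 *v y + M23 *v z)
       (M31 *v x + M32 *v y + M33 *v z)"
  by (simp add: block3_def join3_def matrix_vector_mult_def sum_UNIV_Plus vec_eq_iff add.assoc
      split: sum.split)

lemma minus_matrix_vector_mult: "(- M) *v x = - (M *v (x :: 'a::ring_1^'n))"
  by (simp add: matrix_vector_mult_def vec_eq_iff sum_negf)

lemma saddle_matrix_mult_join3:
  "saddle_matrix A B C *v join3 x y z =
     join3 (A *v x + transpose B *v y) (- (B *v x) - transpose C *v z) (C *v y)"
  by (simp add: saddle_matrix_def block3_mult_join3 minus_matrix_vector_mult)

lemma block_diag3_mult_join3: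
  "block_diag3 L1 L2 L3 *v join3 x y z = join3 (L1 *v x) (L2 *v y) (L3 *v z)"
  by (simp add: block_diag3_def block3_mult_join3)

text \<open>The two \<open>B\<close> terms are adjoint to each other and enter with opposite signs,
  as do the two \<open>C\<close> terms, so only the \<open>A\<close> term survives.\<close>

lemma inner_saddle_matrix:
  "join3 x y z \<bullet> (saddle_matrix A B C *v join3 x y z) = x \<bullet> (A *v x)"
proof -
  have "x \<bullet> (transpose B *v y) = y \<bullet> (B *v x)" "y \<bullet> (transpose C *v z) = z \<bullet> (C *v y)"
    by (metis dot_lmul_matrix inner_commute transpose_matrix_vector)+
  then show ?thesis
    by (simp add: saddle_matrix_mult_join3 inner_join3 inner_add_right inner_diff_right)
qed

section \<open>Positive definiteness, invertibility and generalised eigenproblems\<close>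

lemma sym_pos_def_nonneg: "sym_pos_def M \<Longrightarrow> 0 \<le> x \<bullet> (M *v x)"
  unfolding sym_pos_def_def by (cases "x = 0") (auto intro: less_imp_le)

lemma sym_pos_def_pos: "sym_pos_def M \<Longrightarrow> x \<noteq> 0 \<Longrightarrow> 0 < x \<bullet> (M *v x)"
  unfolding sym_pos_def_def by blast

lemma symmetric_inner_commute:
  assumes "transpose M = (M :: real^'n^'n)"
  shows "x \<bullet> (M *v y) = y \<bullet> (M *v x)"
  by (metis assms dot_lmul_matrix inner_commute transpose_matrix_vector)

lemma sym_pos_def_block_diag3:
  assumes "sym_pos_def L1" "sym_pos_def L2" "sym_pos_def L3"
  shows "sym_pos_def (block_diag3 L1 L2 L3)"
  unfolding sym_pos_def_def
proof (intro conjI allI impI)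
  show "transpose (block_diag3 L1 L2 L3) = block_diag3 L1 L2 L3"
    using assms
    by (simp add: sym_pos_def_def block_diag3_def block3_def transpose_def vec_eq_iff split: sum.split)
next
  fix v :: "real^('a + 'b + 'c)" assume "v \<noteq> 0"
  obtain x y z where v: "v = join3 x y z" by (rule join3_cases)
  have nz: "x \<noteq> 0 \<or> y \<noteq> 0 \<or> z \<noteq> 0" using \<open>v \<noteq> 0\<close> by (auto simp: v join3_0)
  have "0 < x \<bullet> (L1 *v x) + y \<bullet> (L2 *v y) + z \<bullet> (L3 *v z)"
    using nz sym_pos_def_nonneg[OF assms(1), of x] sym_pos_def_nonneg[OF assms(2), of y]
      sym_pos_def_nonneg[OF assms(3), of z] sym_pos_def_pos[OF assms(1), of x]
      sym_pos_def_pos[OF assms(2), of y] sym_pos_def_pos[OF assms(3), of z]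
    by linarith
  then show "0 < v \<bullet> (block_diag3 L1 L2 L3 *v v)"
    by (simp add: v block_diag3_mult_join3 inner_join3)
qed

text \<open>A kernel vector would make the quadratic form vanish. Phrasing this through the form
  alone lets it cover the nonsymmetric preconditioner as well as \<open>\<Lambda>1\<close>.\<close>

lemma invertible_if_inner_pos:
  fixes M :: "real^'n^'n"
  assumes "\<And>x. x \<noteq> 0 \<Longrightarrow> 0 < x \<bullet> (M *v x)"
  shows "invertible M"
  unfolding invertible_left_inverse matrix_left_invertible_ker
  using assms by (metis inner_zero_right less_irrefl)

text \<open>Removes the inverse in favour of a generalised eigenproblem; serves both the
  preconditioned matrix and \<open>matrix_inv L ** A\<close>.\<close>

lemma matrix_inv_mult_eigen_iff:
  fixes P M :: "real^'n^'n"
  assumes "invertible P"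
  shows "(matrix_inv P ** M) *v v = k *s v \<longleftrightarrow> M *v v = k *s (P *v v)"
proof -
  have inv: "P ** matrix_inv P = mat 1" "matrix_inv P ** P = mat 1"
    unfolding matrix_inv_def using someI_ex[OF assms[unfolded invertible_def]] by blast+
  have "matrix_inv P *v (M *v v) = k *s v \<longleftrightarrow> M *v v = P *v (k *s v)"
    by (metis inv matrix_vector_mul_assoc matrix_vector_mul_lid)
  then show ?thesis
    by (simp add: matrix_vector_mul_assoc vec.scale)
qed

section \<open>Finiteness of the set of eigenvalues\<close>

lemma eigenvectors_independent:
  fixes M :: "'a::field^'n^'n"
  assumes "finite K" and "\<And>k. k \<in> K \<Longrightarrow> f k \<noteq> 0" and "\<And>k. k \<in> K \<Longrightarrow> M *v f k = k *s f k"
    and "(\<Sum>k\<in>K. c k *s f k) = 0" and "k \<in> K"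
  shows "c k = 0"
  using assms
proof (induction K arbitrary: c k rule: finite_induct)
  case (insert l K)
  \<comment> \<open>Applying \<open>M - l I\<close> to the relation kills the term of
    \<open>l\<close> and multiplies each other coefficient by \<open>k - l\<close>, which is
    nonzero. The coefficients change, hence the induction over arbitrary \<open>c\<close>.\<close>
  have "0 = M *v (\<Sum>k\<in>insert l K. c k *s f k) - l *s (\<Sum>k\<in>insert l K. c k *s f k)"
    using insert.prems by simp
  also have "\<dots> = (\<Sum>k\<in>insert l K. (c k * (k - l)) *s f k)"
    unfolding vec.sum vec.scale_sum_right sum_subtractf[symmetric]
    using insert.prems(2)
    by (intro sum.cong) (auto simp: vec.scale vec.scale_left_diff_distrib algebra_simps)
  also have "\<dots> = (\<Sum>k\<in>K. (c k * (k - l)) *s f k)"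
    using insert.hyps by simp
  finally have "c k * (k - l) = 0" if "k \<in> K" for k
    using insert.IH[of "\<lambda>k. c k * (k - l)"] insert.prems that by simp
  then have K: "c k = 0" if "k \<in> K" for k
    using that insert.hyps by auto
  then have "c l *s f l = 0"
    using insert.prems(3) insert.hyps by (simp add: sum.neutral)
  then have "c l = 0"
    using insert.prems(1) by simp
  with K show ?case using insert.prems(4) by auto
qed simp

text \<open>More than \<open>CARD('n)\<close> distinct eigenvalues would give too many independent
  eigenvectors. Finiteness is what makes the \<open>Max\<close> in \<open>lambda_max\<close> an
  upper bound.\<close>

lemma finite_eigenvalues:
  fixes M :: "'a::field^'n^'n"
  shows "finite {k. eigenvalue M k}"
proof (rule ccontr)
  assume "infinite {k. eigenvalue M k}"
  then obtain K where K: "K \<subseteq> {k. eigenvalue M k}" "finite K" "card K = Suc CARD('n)"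
    using infinite_arbitrarily_large by blast
  then have "\<forall>k\<in>K. \<exists>v. v \<noteq> 0 \<and> M *v v = k *s v"
    by (auto simp: eigenvalue_def)
  then obtain f where f: "\<And>k. k \<in> K \<Longrightarrow> f k \<noteq> 0" "\<And>k. k \<in> K \<Longrightarrow> M *v f k = k *s f k"
    by metis
  \<comment> \<open>A nonzero vector is an eigenvector for only one eigenvalue.\<close>
  have inj: "inj_on f K"
    by (rule inj_onI) (metis f vec.scale_cancel_right)
  have "vec.independent (f ` K)"
  proof (rule vec.independent_if_scalars_zero)
    fix u v assume u: "(\<Sum>x\<in>f ` K. u x *s x) = 0" and "v \<in> f ` K"
    then obtain k where "k \<in> K" "v = f k" by auto
    moreover have "(\<Sum>k\<in>K. u (f k) *s f k) = 0"
      using u inj by (simp add: sum.reindex)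
    ultimately show "u v = 0"
      using eigenvectors_independent[OF K(2) f, of "\<lambda>k. u (f k)"] by blast
  qed (simp add: K(2))
  then have "card (f ` K) \<le> vec.dim (UNIV :: ('a^'n) set)"
    by (intro vec.independent_card_le_dim) auto
  then show False
    using card_image[OF inj] K(3) by (simp add: vec.dim_UNIV card_cart_basis)
qed

section \<open>The generalised Rayleigh quotient\<close>

text \<open>A zero of a nonnegative form is a minimum, so its gradient, a multiple of
  \<open>M *v x\<close>, vanishes there: otherwise a small step against \<open>M *v x\<close> would
  make the form negative.\<close>

lemma psd_inner_zero_imp_mult_zero:
  fixes M :: "real^'n^'n"
  assumes sym: "transpose M = M" and psd: "\<And>x. 0 \<le> x \<bullet> (M *v x)" and zero: "x \<bullet> (M *v x) = 0"
  shows "M *v x = 0"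
proof (rule ccontr)
  assume ne: "M *v x \<noteq> 0"
  define y where "y = M *v x"
  define a where "a = y \<bullet> (M *v y)"
  define b where "b = y \<bullet> y"
  have b: "b > 0" using ne by (simp add: b_def y_def)
  have q: "0 \<le> 2 * t * b + t^2 * a" for t
  proof -
    have "(x + t *\<^sub>R y) \<bullet> (M *v (x + t *\<^sub>R y)) = 2 * t * b + t^2 * a"
      using zero symmetric_inner_commute[OF sym, of x y]
      by (simp add: matrix_vector_right_distrib matrix_vector_mult_scaleR inner_add_left
          inner_add_right a_def b_def power2_eq_square algebra_simps flip: y_def)
    then show ?thesis using psd by metis
  qed
  have a: "0 \<le> a" using psd by (simp add: a_def)
  \<comment> \<open>Step length with \<open>- 2 * c * b + c^2 * a < 0\<close>; the summand 1 keeps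
    the denominator positive when \<open>a = 0\<close>.\<close>
  define c where "c = b / (a + 1)"
  have c: "c > 0" "b = c * (a + 1)" using a b by (simp_all add: c_def)
  have "2 * (- c) * b + (- c)^2 * a = - (c^2 * (a + 2))"
    by (simp add: c(2) power2_eq_square algebra_simps)
  also have "\<dots> < 0" using a c(1) by simp
  finally show False using q[of "- c"] by linarith
qed

text \<open>The quotient attains its maximum \<open>m\<close> on the compact unit sphere. The
  maximiser is a generalised eigenvector for \<open>m\<close>, so \<open>m\<close> is among the
  eigenvalues that \<open>lambda_max\<close> bounds.\<close>

lemma Rayleigh_quotient_le_lambda_max:
  fixes A L :: "real^'n^'n"
  assumes A: "transpose A = A" and L: "sym_pos_def L"
  shows "x \<bullet> (A *v x) \<le> lambda_max (matrix_inv L ** A) * (x \<bullet> (L *v x))"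
proof -
  define q where "q = (\<lambda>x. (x \<bullet> (A *v x)) / (x \<bullet> (L *v x)))"
  have "continuous_on (sphere 0 1) q"
    unfolding q_def
    by (intro continuous_intros matrix_vector_mult_linear_continuous_on)
      (use sym_pos_def_pos[OF L] in \<open>metis dist_0_norm less_irrefl mem_sphere norm_zero zero_neq_one\<close>)
  moreover have "sphere (0 :: real^'n) 1 \<noteq> {}" by simp
  ultimately obtain u where u: "u \<in> sphere 0 1" "\<And>y. y \<in> sphere 0 1 \<Longrightarrow> q y \<le> q u"
    using continuous_attains_sup[OF compact_sphere] by metis
  define m where "m = q u"
  have u0: "u \<noteq> 0" using u(1) by auto
  have le: "y \<bullet> (A *v y) \<le> m * (y \<bullet> (L *v y))" for y
  proof (cases "y = 0")
    case False
    \<comment> \<open>The quotient is invariant under scaling, so the bound on the sphere holds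
      everywhere.\<close>
    have "q (y /\<^sub>R norm y) = q y"
      using False by (simp add: q_def matrix_vector_mult_scaleR)
    moreover have "y /\<^sub>R norm y \<in> sphere 0 1" using False by simp
    ultimately have "q y \<le> m" using u(2) by (metis m_def)
    then show ?thesis
      using sym_pos_def_pos[OF L False] by (simp add: q_def pos_divide_le_eq)
  qed simp
  \<comment> \<open>The form of \<open>D\<close> is nonnegative by maximality of \<open>m\<close>
    and zero at \<open>u\<close>, so \<open>D *v u = 0\<close>, which is the eigenvector
    equation.\<close>
  define D where "D = m *\<^sub>R L - A"
  have D: "D *v y = m *\<^sub>R (L *v y) - A *v y" for y
    by (simp add: D_def matrix_vector_mult_diff_rdistrib scaleR_matrix_vector_assoc)
  have "D *v u = 0"
  proof (rule psd_inner_zero_imp_mult_zero)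
    show "transpose D = D"
      using A L by (simp add: D_def sym_pos_def_def transpose_def vec_eq_iff)
    show "0 \<le> y \<bullet> (D *v y)" for y
      using le[of y] by (simp add: D inner_diff_right)
    show "u \<bullet> (D *v u) = 0"
      using sym_pos_def_pos[OF L u0] by (simp add: D inner_diff_right m_def q_def)
  qed
  then have "A *v u = m *s (L *v u)"
    by (simp add: D scalar_mult_eq_scaleR)
  moreover have "invertible L"
    using sym_pos_def_pos[OF L] by (rule invertible_if_inner_pos)
  ultimately have "eigenvalue (matrix_inv L ** A) m"
    unfolding eigenvalue_def using u0 matrix_inv_mult_eigen_iff by blast
  then have "m \<le> lambda_max (matrix_inv L ** A)"
    unfolding lambda_max_def by (intro Max_ge finite_eigenvalues) simp
  then show ?thesis
    using le[of x] sym_pos_def_nonneg[OF L, of x] by (meson mult_right_mono order_trans)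
qed

section \<open>The rank conditions and the bound on the eigenvalue\<close>

lemma full_row_rank_transpose_eq_0:
  assumes "full_row_rank M" "transpose M *v y = 0"
  shows "y = 0"
proof -
  have "inj ((*v) (transpose M))"
    using assms(1) by (simp add: full_row_rank_def rank_transpose flip: full_rank_injective)
  then show ?thesis
    using assms(2) by (metis injD matrix_vector_mult_0_right)
qed

theorem theorem4p2:
  fixes A :: "real^'n^'n" and B :: "real^'n^'m" and C :: "real^'m^'p"
    and \<Lambda>1 :: "real^'n^'n" and \<Lambda>2 :: "real^'m^'m" and \<Lambda>3 :: "real^'p^'p"
    and s lam \<xi>max :: real
  assumes "sym_pos_def A"
    and "full_row_rank B" and "full_row_rank C"
    and "sym_pos_def \<Lambda>1" and "sym_pos_def \<Lambda>2" and "sym_pos_def \<Lambda>3"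
    and "s > 0"
    and "\<xi>max = lambda_max (matrix_inv \<Lambda>1 ** A)"
    and "eigenvalue (matrix_inv (P_PESS \<Lambda>1 \<Lambda>2 \<Lambda>3 s A B C) ** saddle_matrix A B C) lam"
  shows "lam \<in> {0 <.. \<xi>max / (1 + s * \<xi>max)}"
proof -
  define S where "S = block_diag3 \<Lambda>1 \<Lambda>2 \<Lambda>3"
  define N where "N = saddle_matrix A B C"
  define P where "P = P_PESS \<Lambda>1 \<Lambda>2 \<Lambda>3 s A B C"
  have S: "sym_pos_def S"
    unfolding S_def using assms(4-6) by (rule sym_pos_def_block_diag3)
  have P: "P *v v = S *v v + s *\<^sub>R (N *v v)" for v
    by (simp add: P_def P_PESS_def S_def N_def matrix_vector_mult_add_rdistrib
        scaleR_matrix_vector_assoc)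
  have N: "0 \<le> v \<bullet> (N *v v)" for v
  proof -
    obtain x y z where "v = join3 x y z" by (rule join3_cases)
    then show ?thesis
      by (simp add: N_def inner_saddle_matrix sym_pos_def_nonneg[OF assms(1)])
  qed
  have "invertible P"
  proof (rule invertible_if_inner_pos)
    fix v :: "real^('n + 'm + 'p)" assume "v \<noteq> 0"
    then show "0 < v \<bullet> (P *v v)"
      using sym_pos_def_pos[OF S] N[of v] assms(7)
      by (simp add: P inner_add_right add_pos_nonneg)
  qed
  then obtain v where v: "v \<noteq> 0" "N *v v = lam *\<^sub>R (P *v v)"
    using assms(9) matrix_inv_mult_eigen_iff[OF \<open>invertible P\<close>]
    unfolding eigenvalue_def P_def[symmetric] N_def[symmetric]
    by (auto simp: scalar_mult_eq_scaleR)
  obtain x y z where xyz: "v = join3 x y z" by (rule join3_cases)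
  have eig: "(1 - s * lam) *\<^sub>R (N *v v) = lam *\<^sub>R (S *v v)"
    using v(2) unfolding P by (simp add: algebra_simps)
  have S_pos: "0 < v \<bullet> (S *v v)" using S v(1) by (rule sym_pos_def_pos)
  \<comment> \<open>If the factor vanished, \<open>eig\<close> and \<open>S *v v \<noteq> 0\<close>
    would force \<open>lam = 0\<close>, but then the factor is 1.\<close>
  have ne: "1 - s * lam \<noteq> 0"
  proof
    assume eq: "1 - s * lam = 0"
    then have "lam *\<^sub>R (S *v v) = 0" using eig by simp
    moreover have "S *v v \<noteq> 0" using S_pos by auto
    ultimately show False using eq by simp
  qed
  define \<mu> where "\<mu> = lam / (1 - s * lam)"
  have "N *v v = (inverse (1 - s * lam) * (1 - s * lam)) *\<^sub>R (N *v v)"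
    using ne by simp
  also have "\<dots> = \<mu> *\<^sub>R (S *v v)"
    unfolding scaleR_scaleR[symmetric] eig by (simp add: \<mu>_def divide_inverse mult.commute)
  finally have \<mu>: "N *v v = \<mu> *\<^sub>R (S *v v)" .
  have inner: "x \<bullet> (A *v x) = \<mu> * (v \<bullet> (S *v v))"
    using \<mu> inner_saddle_matrix[of x y z A B C] by (simp add: N_def xyz)
  have blocks: "A *v x + transpose B *v y = \<mu> *\<^sub>R (\<Lambda>1 *v x)"
    "- (B *v x) - transpose C *v z = \<mu> *\<^sub>R (\<Lambda>2 *v y)"
    using \<mu> by (simp_all add: N_def S_def xyz saddle_matrix_mult_join3 block_diag3_mult_join3
        join3_scaleR join3_eq_iff)
  have "x \<noteq> 0"
  proof
    assume x: "x = 0"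
    \<comment> \<open>With \<open>x = 0\<close> the first block row reduces to
      \<open>transpose B *v y = 0\<close>; with \<open>y = 0\<close> as well, the second reduces to
      \<open>transpose C *v z = 0\<close>.\<close>
    have y: "y = 0"
      using blocks(1) full_row_rank_transpose_eq_0[OF assms(2)] by (simp add: x)
    have "z = 0"
      using blocks(2) full_row_rank_transpose_eq_0[OF assms(3)] by (simp add: x y)
    with x y v(1) show False by (simp add: xyz join3_0)
  qed
  then have "0 < \<mu> * (v \<bullet> (S *v v))"
    using inner sym_pos_def_pos[OF assms(1)] by metis
  then have \<mu>_pos: "0 < \<mu>" using S_pos by (simp add: zero_less_mult_iff)
  have \<Lambda>1_pos: "0 < x \<bullet> (\<Lambda>1 *v x)" using assms(4) \<open>x \<noteq> 0\<close> by (rule sym_pos_def_pos)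
  have "x \<bullet> (\<Lambda>1 *v x) \<le> v \<bullet> (S *v v)"
    using sym_pos_def_nonneg[OF assms(5), of y] sym_pos_def_nonneg[OF assms(6), of z]
    by (simp add: S_def xyz block_diag3_mult_join3 inner_join3)
  then have "\<mu> * (x \<bullet> (\<Lambda>1 *v x)) \<le> x \<bullet> (A *v x)"
    using \<mu>_pos inner by simp
  also have "\<dots> \<le> \<xi>max * (x \<bullet> (\<Lambda>1 *v x))"
    unfolding assms(8) using assms(1,4)
    by (intro Rayleigh_quotient_le_lambda_max) (simp_all add: sym_pos_def_def)
  finally have le: "\<mu> \<le> \<xi>max" using \<Lambda>1_pos by simp
  have pos: "0 < 1 + s * \<mu>" "0 < 1 + s * \<xi>max"
    using \<mu>_pos le assms(7) by (simp_all add: add_pos_pos)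
  \<comment> \<open>Inverts the definition of \<open>\<mu>\<close>, using
    \<open>(1 - s * lam) * (1 + s * \<mu>) = 1\<close>.\<close>
  have lam: "lam = \<mu> / (1 + s * \<mu>)"
    using ne pos(1) by (simp add: \<mu>_def field_simps)
  have "0 < lam" using \<mu>_pos pos by (simp add: lam)
  \<comment> \<open>After cross-multiplication the products \<open>s * \<mu> * \<xi>max\<close>
    cancel, leaving \<open>\<mu> \<le> \<xi>max\<close>.\<close>
  moreover have "lam \<le> \<xi>max / (1 + s * \<xi>max)"
    unfolding lam using pos le by (simp add: divide_le_eq pos_le_divide_eq algebra_simps)
  ultimately show ?thesis by simp
qed

end
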